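(* Let $(X,\ell)$ be a Lorentzian pre-length space. Then $(X,\ell)$ admits a forward completion $(\overline X,\overline\ell)$. Moreover, there exists at most one forward completion $(\overline X,\overline\ell)$ (up to isometry) such that: (i) the time-separation function $\overline\tau=\max(0,\overline\ell)$ is continuous; (ii) the causal relation $\overline\le$ of $\overline X$ is a closed partial order; (iii) for all $\bar x\in\overline X\setminus X$ it holds that $\bar x\in\overline{I^\pm(\bar x)}$.
   Context: Lorentzian pre-length space: a set $X$ with $\ell:X\times X\to\{-\infty\}\cup[0,\infty]$ satisfying $\ell(x,y)+\ell(y,z)\le\ell(x,z)$ for all $x,y,z$ (convention $-\infty+\infty=\infty+(-\infty)=-\infty$ on the left) and $\ell(x,x)\ge 0$ for all $x$, where $X$ carries a topology finer than (at least as fine as) the chronological topology, i.e. the topology generated by the sub-base of all $I^\pm(x)$. The time-separation function is $\tau:=\max(0,\ell)$. Write $x\ll y$ iff $\ell(x,y)>0$, $x\le y$ iff $\ell(x,y)\ge0$; $I^+(x)=\{y:x\ll y\}$, $I^-(x)=\{y:y\ll x\}$, $J^+(x)=\{y:x\le y\}$, $J^-(x)=\{y:y\le x\}$. Forward completeness: $(X,\ell)$ is forward complete if every sequence $(x_k)_k$ for which there is $\hat x\in X$ with $x_k\le x_{k+1}\le\hat x$ for all $k$ converges. Forward completion of $(X,\ell)$: a Lorentzian pre-length space $(\overline X,\overline\ell)$ (with causal relation $\overline\le$) such that: (1) $(\overline X,\overline\ell)$ is forward complete; (2) $J^\pm_{\overline\le}(\bar x)$ is closed in $\overline X$ for all $\bar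 x\in\overline X$; (3) there is an isometric (i.e. $\ell$-preserving) embedding of $(X,\ell)$ into $(\overline X,\overline\ell)$ such that $X$ is forward dense in $\overline X$: for all $\bar x\in\overline X$ there is a sequence $(x_k)_k$ in $X$ with $x_k\,\overline\le\,x_{k+1}\,\overline\le\,\bar x$ and $x_k\to\bar x$. An isometry between Lorentzian pre-length spaces is a bijection $f$ with $\tilde\ell(f(x),f(y))=\ell(x,y)$ for all $x,y$. *)

theory Defs
  imports "HOL-Analysis.Analysis"
begin

text \<open>
  A Lorentzian pre-length space is a pair of a topology, whose \<open>topspace\<close> is the underlying set,
  and a function \<open>l\<close> into \<open>ereal\<close> that is relevant on that set only.

  In \<open>ereal\<close> the sum of \<open>\<infinity>\<close> and \<open>-\<infinity>\<close> is \<open>\<infinity>\<close>; the reverse triangle inequality needs the opposite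
  convention.
\<close>

definition lplus :: "ereal \<Rightarrow> ereal \<Rightarrow> ereal" where
  "lplus a b = (if a = -\<infinity> \<or> b = -\<infinity> then -\<infinity> else a + b)"

definition tau :: "('a \<Rightarrow> 'a \<Rightarrow> ereal) \<Rightarrow> 'a \<Rightarrow> 'a \<Rightarrow> ereal" where
  "tau l x y = max 0 (l x y)"

definition chron :: "('a \<Rightarrow> 'a \<Rightarrow> ereal) \<Rightarrow> 'a \<Rightarrow> 'a \<Rightarrow> bool" where
  "chron l x y \<longleftrightarrow> l x y > 0"

definition causal :: "('a \<Rightarrow> 'a \<Rightarrow> ereal) \<Rightarrow> 'a \<Rightarrow> 'a \<Rightarrow> bool" where
  "causal l x y \<longleftrightarrow> l x y \<ge> 0"

definition Ifut :: "'a set \<Rightarrow> ('a \<Rightarrow> 'a \<Rightarrow> ereal) \<Rightarrow> 'a \<Rightarrow> 'a set" where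
  "Ifut S l x = {y \<in> S. chron l x y}"

definition Ipast :: "'a set \<Rightarrow> ('a \<Rightarrow> 'a \<Rightarrow> ereal) \<Rightarrow> 'a \<Rightarrow> 'a set" where
  "Ipast S l x = {y \<in> S. chron l y x}"

definition Jfut :: "'a set \<Rightarrow> ('a \<Rightarrow> 'a \<Rightarrow> ereal) \<Rightarrow> 'a \<Rightarrow> 'a set" where
  "Jfut S l x = {y \<in> S. causal l x y}"

definition Jpast :: "'a set \<Rightarrow> ('a \<Rightarrow> 'a \<Rightarrow> ereal) \<Rightarrow> 'a \<Rightarrow> 'a set" where
  "Jpast S l x = {y \<in> S. causal l y x}"

text \<open>
  \<open>S\<close> is inserted because \<open>topology_generated_by\<close> does not count the whole space as an
  (empty) intersection of sub-basic sets.
\<close>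

definition chronological_topology :: "'a set \<Rightarrow> ('a \<Rightarrow> 'a \<Rightarrow> ereal) \<Rightarrow> 'a topology" where
  "chronological_topology S l =
     topology_generated_by (insert S (Ifut S l ` S \<union> Ipast S l ` S))"

definition lorentzian_pre_length_space :: "'a topology \<Rightarrow> ('a \<Rightarrow> 'a \<Rightarrow> ereal) \<Rightarrow> bool" where
  "lorentzian_pre_length_space X l \<longleftrightarrow>
     (\<forall>x\<in>topspace X. \<forall>y\<in>topspace X. l x y = -\<infinity> \<or> l x y \<ge> 0) \<and>
     (\<forall>x\<in>topspace X. \<forall>y\<in>topspace X. \<forall>z\<in>topspace X. lplus (l x y) (l y z) \<le> l x z) \<and>
     (\<forall>x\<in>topspace X. l x x \<ge> 0) \<and>
     (\<forall>U. openin (chronological_topology (topspace X) l) U \<longrightarrow> openin X U)"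

definition forward_complete :: "'a topology \<Rightarrow> ('a \<Rightarrow> 'a \<Rightarrow> ereal) \<Rightarrow> bool" where
  "forward_complete X l \<longleftrightarrow>
     (\<forall>s :: nat \<Rightarrow> 'a. range s \<subseteq> topspace X \<longrightarrow>
        (\<exists>u\<in>topspace X. \<forall>k. causal l (s k) (s (Suc k)) \<and> causal l (s (Suc k)) u) \<longrightarrow>
        (\<exists>x. limitin X s x sequentially))"

text \<open>
  Embeddings are injective maps preserving \<open>l\<close>; nothing is required about the topologies.
\<close>

definition isometric_embedding ::
  "'a topology \<Rightarrow> ('a \<Rightarrow> 'a \<Rightarrow> ereal) \<Rightarrow> 'b topology \<Rightarrow> ('b \<Rightarrow> 'b \<Rightarrow> ereal) \<Rightarrow> ('a \<Rightarrow> 'b) \<Rightarrow> bool" where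
  "isometric_embedding X l Y m i \<longleftrightarrow>
     i ` topspace X \<subseteq> topspace Y \<and> inj_on i (topspace X) \<and>
     (\<forall>x\<in>topspace X. \<forall>y\<in>topspace X. m (i x) (i y) = l x y)"

definition isometry ::
  "'a topology \<Rightarrow> ('a \<Rightarrow> 'a \<Rightarrow> ereal) \<Rightarrow> 'b topology \<Rightarrow> ('b \<Rightarrow> 'b \<Rightarrow> ereal) \<Rightarrow> ('a \<Rightarrow> 'b) \<Rightarrow> bool" where
  "isometry X l Y m f \<longleftrightarrow>
     bij_betw f (topspace X) (topspace Y) \<and>
     (\<forall>x\<in>topspace X. \<forall>y\<in>topspace X. m (f x) (f y) = l x y)"

definition forward_dense :: "'a topology \<Rightarrow> ('a \<Rightarrow> 'a \<Rightarrow> ereal) \<Rightarrow> 'a set \<Rightarrow> bool" where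
  "forward_dense Y m D \<longleftrightarrow>
     (\<forall>y\<in>topspace Y. \<exists>s :: nat \<Rightarrow> 'a. range s \<subseteq> D \<and>
        (\<forall>k. causal m (s k) (s (Suc k)) \<and> causal m (s (Suc k)) y) \<and>
        limitin Y s y sequentially)"

text \<open>
  The embedding \<open>i\<close> is an argument, so that \<open>X\<close> can be identified with \<open>i ` topspace X\<close> when
  points of the completion outside \<open>X\<close> are considered.  The type \<open>'b\<close> of points of the completion is
  arbitrary; for the existence of a completion, \<open>'a + 'a set\<close> has room for the points of \<open>X\<close>
  and for the past sets in \<open>X\<close> (down-closures of increasing sequences) that encode missing limits.
\<close>

definition forward_completion ::
  "'a topology \<Rightarrow> ('a \<Rightarrow> 'a \<Rightarrow> ereal) \<Rightarrow> 'b topology \<Rightarrow> ('b \<Rightarrow> 'b \<Rightarrow> ereal) \<Rightarrow> ('a \<Rightarrow> 'b) \<Rightarrow> bool" where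
  "forward_completion X l Y m i \<longleftrightarrow>
     lorentzian_pre_length_space Y m \<and>
     forward_complete Y m \<and>
     (\<forall>y\<in>topspace Y. closedin Y (Jfut (topspace Y) m y) \<and> closedin Y (Jpast (topspace Y) m y)) \<and>
     isometric_embedding X l Y m i \<and>
     forward_dense Y m (i ` topspace X)"

definition continuous_time_separation :: "'a topology \<Rightarrow> ('a \<Rightarrow> 'a \<Rightarrow> ereal) \<Rightarrow> bool" where
  "continuous_time_separation Y m \<longleftrightarrow>
     continuous_map (prod_topology Y Y) euclidean (\<lambda>(x, y). tau m x y)"

definition causal_rel :: "'a topology \<Rightarrow> ('a \<Rightarrow> 'a \<Rightarrow> ereal) \<Rightarrow> ('a \<times> 'a) set" where
  "causal_rel Y m = {(x, y) \<in> topspace Y \<times> topspace Y. causal m x y}"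

definition closed_causal_order :: "'a topology \<Rightarrow> ('a \<Rightarrow> 'a \<Rightarrow> ereal) \<Rightarrow> bool" where
  "closed_causal_order Y m \<longleftrightarrow>
     partial_order_on (topspace Y) (causal_rel Y m) \<and>
     closedin (prod_topology Y Y) (causal_rel Y m)"

definition new_points_approximable ::
  "'a set \<Rightarrow> 'b topology \<Rightarrow> ('b \<Rightarrow> 'b \<Rightarrow> ereal) \<Rightarrow> ('a \<Rightarrow> 'b) \<Rightarrow> bool" where
  "new_points_approximable S Y m i \<longleftrightarrow>
     (\<forall>y \<in> topspace Y - i ` S.
        y \<in> Y closure_of (Ifut (topspace Y) m y) \<and> y \<in> Y closure_of (Ipast (topspace Y) m y))"

end

theory Submission
  imports Defs
begin

text \<open>
  \<^emph>\<open>Existence.\<close> A limit of an increasing sequence should be determined by its past, so the points of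
  the completion are the points \<open>x\<close> of \<open>X\<close>, with past \<open>J\<^sup>-(x)\<close>, together with all unions
  \<open>\<Union>k. J\<^sup>-(s k)\<close> over increasing sequences \<open>s\<close> in \<open>X\<close>, which are their own past. The causal relation is
  inclusion of pasts. For the time separation of \<open>u \<le> v\<close> one takes the supremum over \<open>y\<close> in the past
  of \<open>v\<close> of the infimum over \<open>x\<close> in the past of \<open>u\<close> of \<open>\<tau> x y\<close>. The order of the two operations
  matters: if \<open>v\<close> is an increasing limit of \<open>v k\<close> and \<open>u \<lless> v\<close>, then a single \<open>y\<close> in the past of \<open>v\<close>
  already witnesses \<open>u \<lless> v\<close>, and \<open>y\<close> lies in the past of some \<open>v k\<close>, so that \<open>u \<lless> v k\<close>. With the infimum
  outside, the witness \<open>y\<close> would depend on \<open>x\<close>, and \<open>I\<^sup>+(u)\<close> could fail to contain a tail of the sequence.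
  The topology is the coarsest one that makes all \<open>I\<^sup>\<plusminus>\<close> open and all \<open>J\<^sup>\<plusminus>\<close> closed. An
  increasing sequence converges in it to any point whose past is the union of the pasts of its
  members (\<open>limitin_past_space\<close>), and this union is again generated by one increasing sequence of \<open>X\<close>,
  by a diagonal argument (\<open>chain_past_Union\<close>). Both completeness and density follow.

  \<^emph>\<open>Uniqueness.\<close> Given completions \<open>Y\<close> and \<open>Z\<close>, relate \<open>y\<close> to \<open>z\<close> if one increasing sequence of \<open>X\<close>
  converges to \<open>y\<close> in \<open>Y\<close> and to \<open>z\<close> in \<open>Z\<close>. Continuity makes \<open>\<tau>\<close> agree on related pairs
  (\<open>tau_common_limit\<close>). It remains to compare the causal relations, that is, to see that \<open>p \<le> y\<close> with
  \<open>p\<close> in \<open>X\<close> gives \<open>p \<le> z\<close> (\<open>causal_point_transfer\<close>). If \<open>z\<close> is a point of \<open>X\<close>, it is an upper bound of the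
  sequence, hence \<open>y \<le> z\<close> in \<open>Y\<close>. If \<open>z\<close> is new, it is in the closure of the set of points \<open>q\<close> of \<open>X\<close> with \<open>z \<lless> q\<close>. As \<open>\<tau>\<close>
  agrees, \<open>p \<le> y \<lless> q\<close>, and \<open>p \<le> z\<close> follows because \<open>J\<^sup>+(p)\<close> is closed in \<open>Z\<close>. So the relation preserves
  \<open>\<ell>\<close>, and by antisymmetry it is the graph of an injective partial map. It is defined everywhere because a
  new point \<open>y\<close> has a point of \<open>X\<close> in its future, which bounds the sequence in \<open>Z\<close> too.
\<close>

section \<open>Causality in a Lorentzian pre-length space\<close>

lemma causal_refl:
  assumes "lorentzian_pre_length_space X l" "x \<in> topspace X"
  shows "causal l x x"
  using assms by (auto simp: lorentzian_pre_length_space_def causal_def)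

lemma reverse_triangle:
  assumes "lorentzian_pre_length_space X l" "x \<in> topspace X" "y \<in> topspace X" "z \<in> topspace X"
    and "causal l x y" "causal l y z"
  shows "l x y + l y z \<le> l x z"
proof -
  have "lplus (l x y) (l y z) \<le> l x z"
    using assms by (auto simp: lorentzian_pre_length_space_def)
  moreover have "l x y \<noteq> -\<infinity>" "l y z \<noteq> -\<infinity>"
    using assms by (auto simp: causal_def)
  ultimately show ?thesis by (simp add: lplus_def)
qed

lemma causal_trans:
  assumes "lorentzian_pre_length_space X l" "x \<in> topspace X" "y \<in> topspace X" "z \<in> topspace X"
    and "causal l x y" "causal l y z"
  shows "causal l x z"
  using reverse_triangle[OF assms] assms(5,6) unfolding causal_def
  by (meson add_nonneg_nonneg order_trans)

lemma chron_imp_causal: "chron l x y \<Longrightarrow> causal l x y"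
  by (simp add: chron_def causal_def)

text \<open>
  The value \<open>l y z\<close> is either nonnegative, and then the reverse triangle inequality applies, or \<open>-\<infinity>\<close>.
\<close>

lemma l_antimono_left:
  assumes "lorentzian_pre_length_space X l" "x \<in> topspace X" "y \<in> topspace X" "z \<in> topspace X"
    and "causal l x y"
  shows "l y z \<le> l x z"
proof (cases "causal l y z")
  case True
  have "0 + l y z \<le> l x y + l y z"
    using assms(5) by (intro add_right_mono) (simp add: causal_def)
  then show ?thesis
    using reverse_triangle[OF assms True] by simp
next
  case False
  then have "l y z = -\<infinity>"
    using assms by (auto simp: lorentzian_pre_length_space_def causal_def)
  then show ?thesis by simp
qed

lemma l_mono_right:
  assumes "lorentzian_pre_length_space X l" "x \<in> topspace X" "y \<in> topspace X" "z \<in> topspace X"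
    and "causal l y z"
  shows "l x y \<le> l x z"
proof (cases "causal l x y")
  case True
  have "l x y + 0 \<le> l x y + l y z"
    using assms(5) by (intro add_left_mono) (simp add: causal_def)
  then show ?thesis
    using reverse_triangle[OF assms(1-4) True assms(5)] by simp
next
  case False
  then have "l x y = -\<infinity>"
    using assms by (auto simp: lorentzian_pre_length_space_def causal_def)
  then show ?thesis by simp
qed

lemma openin_Ifut:
  assumes "lorentzian_pre_length_space X l" "x \<in> topspace X"
  shows "openin X (Ifut (topspace X) l x)"
proof -
  have "openin (chronological_topology (topspace X) l) (Ifut (topspace X) l x)"
    unfolding chronological_topology_def
    using assms(2) by (intro topology_generated_by_Basis) auto
  then show ?thesis
    using assms(1) by (auto simp: lorentzian_pre_length_space_def)
qed

definition causal_chain :: "'a set \<Rightarrow> ('a \<Rightarrow> 'a \<Rightarrow> ereal) \<Rightarrow> (nat \<Rightarrow> 'a) \<Rightarrow> bool" where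
  "causal_chain S l s \<longleftrightarrow> range s \<subseteq> S \<and> (\<forall>k. causal l (s k) (s (Suc k)))"

lemma causal_chain_mono:
  assumes "lorentzian_pre_length_space X l" "causal_chain (topspace X) l s" "a \<le> b"
  shows "causal l (s a) (s b)"
  using assms(3)
proof (induction rule: dec_induct)
  case base
  then show ?case using causal_refl assms by (fastforce simp: causal_chain_def)
next
  case (step k)
  show ?case
    by (rule causal_trans[OF assms(1) _ _ _ step.IH])
      (use assms(2) in \<open>auto simp: causal_chain_def\<close>)
qed

section \<open>The topology of chronological and causal half-spaces\<close>

definition causal_topology :: "'a set \<Rightarrow> ('a \<Rightarrow> 'a \<Rightarrow> ereal) \<Rightarrow> 'a topology" where
  "causal_topology S l = topology_generated_by
     (insert S (Ifut S l ` S \<union> Ipast S l ` S \<union>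
        (\<lambda>x. S - Jfut S l x) ` S \<union> (\<lambda>x. S - Jpast S l x) ` S))"

lemma topspace_causal_topology [simp]: "topspace (causal_topology S l) = S"
  by (auto simp: causal_topology_def Ifut_def Ipast_def)

lemma openin_topology_generated_by_mono:
  assumes "openin (topology_generated_by A) U" "A \<subseteq> B"
  shows "openin (topology_generated_by B) U"
proof -
  have "generate_topology_on A U"
    using assms(1) by (simp add: openin_topology_generated_by_iff)
  then have "generate_topology_on B U"
    by induction (use assms(2) in \<open>auto intro: generate_topology_on.intros\<close>)
  then show ?thesis by (simp add: openin_topology_generated_by_iff)
qed

lemma causal_topology_finer:
  "openin (chronological_topology S l) U \<Longrightarrow> openin (causal_topology S l) U"
  unfolding chronological_topology_def causal_topology_def
  by (erule openin_topology_generated_by_mono) blast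

lemma closedin_causal_topology:
  assumes "x \<in> S"
  shows "closedin (causal_topology S l) (Jfut S l x)"
    and "closedin (causal_topology S l) (Jpast S l x)"
proof -
  have "openin (causal_topology S l) (S - Jfut S l x)" "openin (causal_topology S l) (S - Jpast S l x)"
    unfolding causal_topology_def using assms by (auto intro!: topology_generated_by_Basis)
  then show "closedin (causal_topology S l) (Jfut S l x)" "closedin (causal_topology S l) (Jpast S l x)"
    unfolding closedin_def by (auto simp: Jfut_def Jpast_def)
qed

lemma limitin_topology_generated_by:
  assumes "x \<in> \<Union>A" "\<And>U. U \<in> A \<Longrightarrow> x \<in> U \<Longrightarrow> eventually (\<lambda>k. s k \<in> U) F"
  shows "limitin (topology_generated_by A) s x F"
proof -
  have "x \<in> U \<longrightarrow> eventually (\<lambda>k. s k \<in> U) F" if "generate_topology_on A U" for U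
    using that
  proof induction
    case (Int a b)
    then show ?case by (auto intro: eventually_conj)
  next
    case (UN K)
    show ?case
    proof
      assume "x \<in> \<Union>K"
      then obtain k where "k \<in> K" "x \<in> k" by blast
      with UN.IH have "eventually (\<lambda>n. s n \<in> k) F" by blast
      then show "eventually (\<lambda>n. s n \<in> \<Union>K) F"
        by (rule eventually_mono) (use \<open>k \<in> K\<close> in blast)
    qed
  qed (use assms in auto)
  then show ?thesis
    using assms(1) by (auto simp: limitin_def openin_topology_generated_by_iff)
qed

text \<open>
  There are four kinds of sub-basic neighbourhoods of \<open>x\<close>. Since \<open>x\<close> is an upper bound, \<open>I\<^sup>-(z)\<close> and the
  complement of \<open>J\<^sup>+(z)\<close> contain the whole sequence. The complement of \<open>J\<^sup>-(z)\<close> contains a tail because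
  \<open>x\<close> is least among the upper bounds, and \<open>I\<^sup>+(z)\<close> contains a tail by the approximation hypothesis.
\<close>

lemma limitin_causal_topology:
  assumes lor: "lorentzian_pre_length_space (causal_topology S l) l"
    and s: "causal_chain S l s" and x: "x \<in> S"
    and ub: "\<And>k. causal l (s k) x"
    and least: "\<And>z. z \<in> S \<Longrightarrow> (\<And>k. causal l (s k) z) \<Longrightarrow> causal l x z"
    and approx: "\<And>z. z \<in> S \<Longrightarrow> chron l z x \<Longrightarrow> \<exists>k. chron l z (s k)"
  shows "limitin (causal_topology S l) s x sequentially"
  unfolding causal_topology_def
proof (rule limitin_topology_generated_by)
  note lor' = lor[THEN causal_trans, simplified] lor[THEN l_mono_right, simplified]
    lor[THEN l_antimono_left, simplified]
  have sS: "s k \<in> S" for k using s by (auto simp: causal_chain_def)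
  have mono: "causal l (s a) (s b)" if "a \<le> b" for a b
    using causal_chain_mono[OF lor, simplified, OF s that] .
  fix U
  assume "U \<in> insert S (Ifut S l ` S \<union> Ipast S l ` S \<union>
        (\<lambda>x. S - Jfut S l x) ` S \<union> (\<lambda>x. S - Jpast S l x) ` S)" and xU: "x \<in> U"
  then consider "U = S" | z where "z \<in> S" "U = Ifut S l z" | z where "z \<in> S" "U = Ipast S l z"
    | z where "z \<in> S" "U = S - Jfut S l z" | z where "z \<in> S" "U = S - Jpast S l z"
    by blast
  then show "\<forall>\<^sub>F k in sequentially. s k \<in> U"
  proof cases
    case 1
    then show ?thesis using sS by simp
  next
    case (2 z)
    then obtain N where N: "chron l z (s N)"
      using approx xU by (auto simp: Ifut_def)
    have "s k \<in> U" if "k \<ge> N" for k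
    proof -
      have "l z (s N) \<le> l z (s k)"
        using lor'(2) 2 sS mono that by blast
      then show ?thesis using N 2 sS by (auto simp: Ifut_def chron_def)
    qed
    then show ?thesis by (auto simp: eventually_sequentially)
  next
    case (3 z)
    have "l x z \<le> l (s k) z" for k
      using lor'(3) 3 x sS ub by blast
    then have "s k \<in> U" for k
      using 3 xU sS unfolding Ipast_def chron_def by (auto intro: less_le_trans)
    then show ?thesis by simp
  next
    case (4 z)
    have "s k \<in> U" for k
      using 4 xU lor'(1)[of z "s k" x] ub x sS by (auto simp: Jfut_def)
    then show ?thesis by simp
  next
    case (5 z)
    then obtain N where N: "\<not> causal l (s N) z"
      using least xU x by (auto simp: Jpast_def)
    have "s k \<in> U" if "k \<ge> N" for k
      using 5 N lor'(1)[of "s N" "s k" z] mono[OF that] sS by (auto simp: Jpast_def)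
    then show ?thesis by (auto simp: eventually_sequentially)
  qed
qed (use x in auto)

section \<open>The completion by past sets\<close>

definition chain_past :: "'a topology \<Rightarrow> ('a \<Rightarrow> 'a \<Rightarrow> ereal) \<Rightarrow> 'a set \<Rightarrow> bool" where
  "chain_past X l P \<longleftrightarrow>
     (\<exists>s. causal_chain (topspace X) l s \<and> P = (\<Union>k. Jpast (topspace X) l (s k)))"

definition past_of :: "'a topology \<Rightarrow> ('a \<Rightarrow> 'a \<Rightarrow> ereal) \<Rightarrow> 'a + 'a set \<Rightarrow> 'a set" where
  "past_of X l u = (case u of Inl x \<Rightarrow> Jpast (topspace X) l x | Inr P \<Rightarrow> P)"

definition past_points :: "'a topology \<Rightarrow> ('a \<Rightarrow> 'a \<Rightarrow> ereal) \<Rightarrow> ('a + 'a set) set" where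
  "past_points X l = Inl ` topspace X \<union> Inr ` {P. chain_past X l P}"

text \<open>
  The supremum stands outside so that one \<open>y\<close> witnesses a positive value for all \<open>x\<close> simultaneously. This
  is what makes chronological futures open. Using \<open>tau\<close> instead of \<open>l\<close> inside keeps
  the value nonnegative if the past of \<open>u\<close> is included in that of \<open>v\<close> and yet has no upper bound there.
\<close>

definition past_sep ::
  "'a topology \<Rightarrow> ('a \<Rightarrow> 'a \<Rightarrow> ereal) \<Rightarrow> 'a + 'a set \<Rightarrow> 'a + 'a set \<Rightarrow> ereal" where
  "past_sep X l u v =
     (if past_of X l u \<subseteq> past_of X l v
      then SUP y\<in>past_of X l v. INF x\<in>past_of X l u. tau l x y else -\<infinity>)"

definition past_space :: "'a topology \<Rightarrow> ('a \<Rightarrow> 'a \<Rightarrow> ereal) \<Rightarrow> ('a + 'a set) topology" where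
  "past_space X l = causal_topology (past_points X l) (past_sep X l)"

lemma topspace_past_space [simp]: "topspace (past_space X l) = past_points X l"
  by (simp add: past_space_def)

context
  fixes X :: "'a topology" and l :: "'a \<Rightarrow> 'a \<Rightarrow> ereal"
  assumes lor: "lorentzian_pre_length_space X l"
begin

lemma chain_past_past_of:
  assumes "u \<in> past_points X l"
  shows "chain_past X l (past_of X l u)"
proof (cases u)
  case (Inl x)
  then have "x \<in> topspace X" using assms by (auto simp: past_points_def)
  then have "causal_chain (topspace X) l (\<lambda>_. x)"
    using causal_refl[OF lor] by (auto simp: causal_chain_def)
  then show ?thesis unfolding chain_past_def past_of_def Inl
    by (intro exI[of _ "\<lambda>_. x"]) auto
qed (use assms in \<open>auto simp: past_points_def past_of_def\<close>)

lemma chain_past_subset: "chain_past X l P \<Longrightarrow> P \<subseteq> topspace X"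
  by (auto simp: chain_past_def Jpast_def)

lemma chain_past_nonempty:
  assumes "chain_past X l P"
  shows "P \<noteq> {}"
proof -
  obtain s where s: "causal_chain (topspace X) l s" "P = (\<Union>k. Jpast (topspace X) l (s k))"
    using assms by (auto simp: chain_past_def)
  then have "s 0 \<in> P" using causal_refl[OF lor] by (fastforce simp: Jpast_def causal_chain_def)
  then show ?thesis by blast
qed

lemma chain_past_downward:
  assumes "chain_past X l P" "y \<in> P" "x \<in> topspace X" "causal l x y"
  shows "x \<in> P"
proof -
  obtain s where s: "causal_chain (topspace X) l s" "P = (\<Union>k. Jpast (topspace X) l (s k))"
    using assms by (auto simp: chain_past_def)
  then obtain k where "y \<in> topspace X" "causal l y (s k)" "s k \<in> topspace X"
    using assms by (auto simp: Jpast_def causal_chain_def)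
  then have "causal l x (s k)" using causal_trans[OF lor] assms by blast
  then show ?thesis using s assms by (auto simp: Jpast_def)
qed

lemma chain_past_directed:
  assumes "chain_past X l P" "x \<in> P" "y \<in> P"
  shows "\<exists>z\<in>P. causal l x z \<and> causal l y z"
proof -
  obtain s where s: "causal_chain (topspace X) l s" "P = (\<Union>k. Jpast (topspace X) l (s k))"
    using assms by (auto simp: chain_past_def)
  have sS: "s k \<in> topspace X" for k using s by (auto simp: causal_chain_def)
  obtain a b where ab: "causal l x (s a)" "causal l y (s b)"
    using assms s by (auto simp: Jpast_def)
  have "causal l x (s (max a b))" "causal l y (s (max a b))"
    using ab causal_chain_mono[OF lor s(1), of a "max a b"] causal_chain_mono[OF lor s(1), of b "max a b"]
      causal_trans[OF lor] sS chain_past_subset[OF assms(1)] assms(2,3)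
    by (meson max.cobounded1 max.cobounded2 subsetD)+
  moreover have "s (max a b) \<in> P"
    using s(2) sS causal_refl[OF lor] by (auto simp: Jpast_def)
  ultimately show ?thesis by blast
qed

text \<open>
  Past sets of increasing sequences are the directed down-sets with a countable cofinal subset. An increasing
  union of them is directed and a down-set, and enumerating all generating sequences gives a
  countable cofinal subset; dependent choice turns that enumeration into one increasing sequence.
\<close>

lemma chain_past_Union:
  assumes P: "\<And>n. chain_past X l (P n)" and inc: "\<And>n. P n \<subseteq> P (Suc n)"
  shows "chain_past X l (\<Union>n. P n)"
proof -
  let ?J = "Jpast (topspace X) l" and ?Q = "\<Union>n. P n"
  have inc': "P a \<subseteq> P b" if "a \<le> b" for a b
    using that inc by (rule lift_Suc_mono_le[of P, rotated])
  obtain s where s: "\<And>n. causal_chain (topspace X) l (s n)" "\<And>n. P n = (\<Union>k. ?J (s n k))"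
    using P unfolding chain_past_def by metis
  have sS: "s n k \<in> topspace X" for n k using s by (auto simp: causal_chain_def)
  have sP: "s n k \<in> P n" for n k
    unfolding s(2)[of n] Jpast_def using sS causal_refl[OF lor sS[of n k]] by blast
  have QS: "?Q \<subseteq> topspace X" using P chain_past_subset by blast
  have dir: "\<exists>z\<in>?Q. causal l x z \<and> causal l y z" if xy: "x \<in> ?Q" "y \<in> ?Q" for x y
  proof -
    obtain a b where "x \<in> P a" "y \<in> P b" using xy by blast
    then have "x \<in> P (max a b)" "y \<in> P (max a b)"
      using inc'[of a "max a b"] inc'[of b "max a b"] by auto
    then show ?thesis using chain_past_directed[OF P] by blast
  qed
  \<comment> \<open>An enumeration of all members of all generating sequences; it is cofinal in the union.\<close>
  define c where "c k = s (fst (prod_decode k)) (snd (prod_decode k))" for k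
  have cQ: "c k \<in> ?Q" for k using sP by (auto simp: c_def)
  have "\<exists>q. \<forall>n. (q n \<in> ?Q \<and> causal l (c n) (q n)) \<and> causal l (q n) (q (Suc n))"
  proof (rule dependent_nat_choice)
    show "\<exists>x. x \<in> ?Q \<and> causal l (c 0) x" using dir[OF cQ cQ] by blast
  next
    fix x n assume "x \<in> ?Q \<and> causal l (c n) x"
    then show "\<exists>y. (y \<in> ?Q \<and> causal l (c (Suc n)) y) \<and> causal l x y"
      using dir[of x "c (Suc n)"] cQ by blast
  qed
  then obtain q where q: "\<And>n. q n \<in> ?Q" "\<And>n. causal l (c n) (q n)"
      "\<And>n. causal l (q n) (q (Suc n))" by blast
  have "causal_chain (topspace X) l q"
    using q QS by (auto simp: causal_chain_def)
  moreover have "?Q = (\<Union>k. ?J (q k))"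
  proof
    show "?Q \<subseteq> (\<Union>k. ?J (q k))"
    proof
      fix x assume "x \<in> ?Q"
      then obtain n k where nk: "x \<in> topspace X" "causal l x (s n k)"
        using s(2) by (auto simp: Jpast_def)
      have "causal l (s n k) (q (prod_encode (n, k)))"
        using q(2)[of "prod_encode (n, k)"] by (simp add: c_def)
      moreover have "q (prod_encode (n, k)) \<in> topspace X" using q(1) QS by blast
      ultimately have "causal l x (q (prod_encode (n, k)))"
        using causal_trans[OF lor nk(1) sS _ nk(2)] by blast
      then show "x \<in> (\<Union>k. ?J (q k))" using nk by (auto simp: Jpast_def)
    qed
    show "(\<Union>k. ?J (q k)) \<subseteq> ?Q"
    proof
      fix x assume "x \<in> (\<Union>k. ?J (q k))"
      then obtain k where k: "x \<in> topspace X" "causal l x (q k)" by (auto simp: Jpast_def)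
      obtain n where "q k \<in> P n" using q(1) by blast
      then show "x \<in> ?Q" using chain_past_downward[OF P] k by blast
    qed
  qed
  ultimately show ?thesis unfolding chain_past_def by blast
qed

lemma causal_past_sep:
  assumes "v \<in> past_points X l"
  shows "causal (past_sep X l) u v \<longleftrightarrow> past_of X l u \<subseteq> past_of X l v"
proof -
  obtain y where "y \<in> past_of X l v"
    using chain_past_nonempty[OF chain_past_past_of[OF assms]] by blast
  then have "0 \<le> (SUP y\<in>past_of X l v. INF x\<in>past_of X l u. tau l x y)"
    by (rule SUP_upper2) (auto intro: INF_greatest simp: tau_def)
  then show ?thesis by (auto simp: causal_def past_sep_def)
qed

text \<open>
  The function \<open>tau\<close> itself violates the reverse triangle inequality when one of its values vanishes
  for lack of causality. Here such a value is harmless: if one infimum is zero, inclusion of the pasts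
  bounds the other one; if both are positive, \<open>y\<close> lies strictly between \<open>x\<close> and \<open>z\<close> for every \<open>x\<close>.
\<close>

lemma past_sep_triangle_aux:
  assumes u: "u \<in> past_points X l" and v: "v \<in> past_points X l" and w: "w \<in> past_points X l"
    and uv: "past_of X l u \<subseteq> past_of X l v" and vw: "past_of X l v \<subseteq> past_of X l w"
    and y: "y \<in> past_of X l v" and z: "z \<in> past_of X l w"
  shows "(INF x\<in>past_of X l u. tau l x y) + (INF y\<in>past_of X l v. tau l y z) \<le> past_sep X l u w"
    (is "?A + ?B \<le> _")
proof -
  have uw: "past_sep X l u w = (SUP z\<in>past_of X l w. INF x\<in>past_of X l u. tau l x z)"
    using order_trans[OF uv vw] by (simp add: past_sep_def)
  have low: "(INF x\<in>past_of X l u. tau l x z') \<le> past_sep X l u w" if "z' \<in> past_of X l w" for z'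
    unfolding uw using that by (rule SUP_upper)
  have sub: "past_of X l u \<subseteq> topspace X" "past_of X l v \<subseteq> topspace X" "past_of X l w \<subseteq> topspace X"
    using u v w chain_past_past_of chain_past_subset by blast+
  have nonneg: "?A \<ge> 0" "?B \<ge> 0"
    by (auto intro: INF_greatest simp: tau_def)
  consider "?A = 0" | "?B = 0" | "?A > 0" "?B > 0" using nonneg by fastforce
  then show ?thesis
  proof cases
    case 1
    have "?B \<le> (INF x\<in>past_of X l u. tau l x z)"
      using uv by (rule INF_superset_mono) simp
    then show ?thesis using low[OF z] 1 by (simp add: order_trans)
  next
    case 2
    then show ?thesis using low[of y] y vw by auto
  next
    case 3
    have "?A + ?B \<le> tau l x z" if x: "x \<in> past_of X l u" for x
    proof -
      have A: "?A \<le> tau l x y" and B: "?B \<le> tau l y z"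
        using x y by (auto intro: INF_lower)
      have "tau l x y > 0" "tau l y z > 0"
        using 3 A B by auto
      then have pos: "l x y > 0" "l y z > 0"
        by (auto simp: tau_def max_def split: if_splits)
      then have eq: "tau l x y = l x y" "tau l y z = l y z" by (auto simp: tau_def max_def)
      have "l x y + l y z \<le> l x z"
        by (rule reverse_triangle[OF lor]) (use x y z sub pos in \<open>auto simp: causal_def\<close>)
      also have "\<dots> \<le> tau l x z" by (simp add: tau_def)
      finally show ?thesis using add_mono[OF A B] eq by simp
    qed
    then have "?A + ?B \<le> (INF x\<in>past_of X l u. tau l x z)" by (rule INF_greatest)
    also have "\<dots> \<le> past_sep X l u w" by (rule low[OF z])
    finally show ?thesis .
  qed
qed

lemma past_sep_triangle:
  assumes u: "u \<in> past_points X l" and v: "v \<in> past_points X l" and w: "w \<in> past_points X l"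
  shows "lplus (past_sep X l u v) (past_sep X l v w) \<le> past_sep X l u w"
proof (cases "past_of X l u \<subseteq> past_of X l v \<and> past_of X l v \<subseteq> past_of X l w")
  case False
  then show ?thesis by (auto simp: lplus_def past_sep_def)
next
  case True
  let ?f = "\<lambda>y. INF x\<in>past_of X l u. tau l x y" and ?g = "\<lambda>z. INF y\<in>past_of X l v. tau l y z"
  have uv: "past_sep X l u v = (SUP y\<in>past_of X l v. ?f y)"
    and vw: "past_sep X l v w = (SUP z\<in>past_of X l w. ?g z)"
    using True by (auto simp: past_sep_def)
  have ne: "past_of X l v \<noteq> {}" "past_of X l w \<noteq> {}"
    using v w chain_past_past_of chain_past_nonempty by blast+
  have nonneg: "0 \<le> past_sep X l u v" "0 \<le> past_sep X l v w"
    using True v w causal_past_sep by (auto simp: causal_def)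
  have "?f y + past_sep X l v w \<le> past_sep X l u w" if y: "y \<in> past_of X l v" for y
  proof -
    have "0 \<le> ?f y" by (auto intro: INF_greatest simp: tau_def)
    then have "?f y + past_sep X l v w = (SUP z\<in>past_of X l w. ?f y + ?g z)"
      unfolding vw using ne by (subst SUP_ereal_add_right) auto
    also have "\<dots> \<le> past_sep X l u w"
      by (rule SUP_least) (use past_sep_triangle_aux[OF u v w] True y in blast)
    finally show ?thesis .
  qed
  then have "(SUP y\<in>past_of X l v. ?f y + past_sep X l v w) \<le> past_sep X l u w"
    by (rule SUP_least)
  moreover have "(SUP y\<in>past_of X l v. ?f y + past_sep X l v w) = past_sep X l u v + past_sep X l v w"
    unfolding uv using ne nonneg by (subst SUP_ereal_add_left) auto
  ultimately show ?thesis by (simp add: lplus_def)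
qed

lemma lorentzian_past_space: "lorentzian_pre_length_space (past_space X l) (past_sep X l)"
  unfolding lorentzian_pre_length_space_def topspace_past_space
proof (intro conjI ballI allI impI)
  fix u v assume uv: "u \<in> past_points X l" "v \<in> past_points X l"
  show "past_sep X l u v = -\<infinity> \<or> 0 \<le> past_sep X l u v"
    using causal_past_sep[OF uv(2), of u] by (auto simp: causal_def past_sep_def)
  show "0 \<le> past_sep X l u u"
    using causal_past_sep[OF uv(1), of u] by (auto simp: causal_def)
  show "lplus (past_sep X l u v) (past_sep X l v w) \<le> past_sep X l u w"
    if "w \<in> past_points X l" for w
    using past_sep_triangle uv that by blast
next
  fix U assume "openin (chronological_topology (past_points X l) (past_sep X l)) U"
  then show "openin (past_space X l) U"
    unfolding past_space_def by (rule causal_topology_finer)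
qed

text \<open>
  The union of the pasts is the least upper bound with respect to inclusion, and a point \<open>y\<close> that witnesses
  \<open>z \<lless> u\<close> belongs to the past of some \<open>s k\<close>, where it witnesses \<open>z \<lless> s k\<close>.
\<close>

lemma limitin_past_space:
  assumes s: "causal_chain (past_points X l) (past_sep X l) s" and u: "u \<in> past_points X l"
    and U: "past_of X l u = (\<Union>k. past_of X l (s k))"
  shows "limitin (past_space X l) s u sequentially"
  unfolding past_space_def
proof (rule limitin_causal_topology[OF lorentzian_past_space[unfolded past_space_def] s u])
  show "causal (past_sep X l) (s k) u" for k
    using causal_past_sep[OF u] U by auto
  show "causal (past_sep X l) u z"
    if "z \<in> past_points X l" "\<And>k. causal (past_sep X l) (s k) z" for z
    using causal_past_sep[OF that(1)] that(2) U by auto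
  fix z assume z: "z \<in> past_points X l" "chron (past_sep X l) z u"
  then have "0 < (SUP y\<in>past_of X l u. INF x\<in>past_of X l z. tau l x y)"
    by (auto simp: chron_def past_sep_def split: if_splits)
  then obtain y where y: "y \<in> past_of X l u" "0 < (INF x\<in>past_of X l z. tau l x y)"
    by (auto simp: less_SUP_iff)
  then obtain k where k: "y \<in> past_of X l (s k)" using U by auto
  have sk: "s k \<in> past_points X l" using s by (auto simp: causal_chain_def)
  \<comment> \<open>A positive infimum means that all of the past of \<open>z\<close> lies below \<open>y\<close>.\<close>
  have "past_of X l z \<subseteq> past_of X l (s k)"
  proof
    fix x assume x: "x \<in> past_of X l z"
    then have "(INF x\<in>past_of X l z. tau l x y) \<le> tau l x y" by (rule INF_lower)
    then have "0 < tau l x y" using y by simp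
    then have "causal l x y" by (auto simp: tau_def causal_def max_def split: if_splits)
    then show "x \<in> past_of X l (s k)"
      using chain_past_downward[OF chain_past_past_of[OF sk] k] x
        chain_past_subset[OF chain_past_past_of[OF z(1)]] by blast
  qed
  then have "(INF x\<in>past_of X l z. tau l x y) \<le> past_sep X l z (s k)"
    using k by (auto simp: past_sep_def intro: SUP_upper)
  then show "\<exists>k. chron (past_sep X l) z (s k)"
    using y(2) by (auto simp: chron_def intro: less_le_trans)
qed

lemma forward_complete_past_space: "forward_complete (past_space X l) (past_sep X l)"
  unfolding forward_complete_def
proof (intro allI impI)
  fix s :: "nat \<Rightarrow> 'a + 'a set"
  assume s: "range s \<subseteq> topspace (past_space X l)"
    and "\<exists>u\<in>topspace (past_space X l).
      \<forall>k. causal (past_sep X l) (s k) (s (Suc k)) \<and> causal (past_sep X l) (s (Suc k)) u"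
  then have chain: "causal_chain (past_points X l) (past_sep X l) s"
    by (auto simp: causal_chain_def)
  have pts: "s k \<in> past_points X l" for k using s by auto
  have "past_of X l (s k) \<subseteq> past_of X l (s (Suc k))" for k
    using chain causal_past_sep[OF pts] by (auto simp: causal_chain_def)
  then have "chain_past X l (\<Union>k. past_of X l (s k))"
    by (intro chain_past_Union chain_past_past_of pts)
  then have "Inr (\<Union>k. past_of X l (s k)) \<in> past_points X l"
    by (simp add: past_points_def)
  then have "limitin (past_space X l) s (Inr (\<Union>k. past_of X l (s k))) sequentially"
    by (rule limitin_past_space[OF chain]) (simp add: past_of_def)
  then show "\<exists>u. limitin (past_space X l) s u sequentially" by blast
qed

text \<open>
  By monotonicity of \<open>tau\<close>, the supremum over \<open>J\<^sup>-(y)\<close> is attained at \<open>y\<close> and the infimum over \<open>J\<^sup>-(x)\<close>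
  at \<open>x\<close>.
\<close>

lemma past_sep_Inl:
  assumes x: "x \<in> topspace X" and y: "y \<in> topspace X"
  shows "past_sep X l (Inl x) (Inl y) = l x y"
proof (cases "causal l x y")
  case False
  then have "l x y = -\<infinity>"
    using assms lor by (auto simp: lorentzian_pre_length_space_def causal_def)
  moreover have "x \<in> Jpast (topspace X) l x" "x \<notin> Jpast (topspace X) l y"
    using False x causal_refl[OF lor] by (auto simp: Jpast_def)
  ultimately show ?thesis by (auto simp: past_sep_def past_of_def)
next
  case True
  let ?J = "Jpast (topspace X) l"
  have refl: "x \<in> ?J x" "y \<in> ?J y" using x y causal_refl[OF lor] by (auto simp: Jpast_def)
  have "?J x \<subseteq> ?J y" using causal_trans[OF lor _ x y _ True] by (auto simp: Jpast_def)
  then have "past_sep X l (Inl x) (Inl y) = (SUP y'\<in>?J y. INF x'\<in>?J x. tau l x' y')"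
    by (simp add: past_sep_def past_of_def)
  also have "\<dots> = tau l x y"
  proof (rule antisym)
    have "(INF x'\<in>?J x. tau l x' y') \<le> tau l x y" if "y' \<in> ?J y" for y'
    proof -
      have "(INF x'\<in>?J x. tau l x' y') \<le> tau l x y'" using refl(1) by (rule INF_lower)
      also have "\<dots> \<le> tau l x y"
        using l_mono_right[OF lor x _ y, of y'] that by (auto simp: tau_def Jpast_def max.coboundedI2)
      finally show ?thesis .
    qed
    then show "(SUP y'\<in>?J y. INF x'\<in>?J x. tau l x' y') \<le> tau l x y" by (rule SUP_least)
    have "tau l x y \<le> tau l x' y" if "x' \<in> ?J x" for x'
      using l_antimono_left[OF lor _ x y, of x'] that by (auto simp: tau_def Jpast_def max.coboundedI2)
    then have "tau l x y \<le> (INF x'\<in>?J x. tau l x' y)" by (rule INF_greatest)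
    then show "tau l x y \<le> (SUP y'\<in>?J y. INF x'\<in>?J x. tau l x' y')"
      by (rule SUP_upper2[OF refl(2)])
  qed
  also have "\<dots> = l x y" using True by (simp add: tau_def causal_def max_def)
  finally show ?thesis .
qed

lemma forward_dense_past_space:
  "forward_dense (past_space X l) (past_sep X l) (Inl ` topspace X)"
  unfolding forward_dense_def topspace_past_space
proof
  fix u assume u: "u \<in> past_points X l"
  then obtain s where s: "causal_chain (topspace X) l s"
    and U: "past_of X l u = (\<Union>k. Jpast (topspace X) l (s k))"
    using chain_past_past_of[OF u] unfolding chain_past_def by blast
  have sS: "s k \<in> topspace X" for k using s by (auto simp: causal_chain_def)
  let ?t = "\<lambda>k. (Inl (s k) :: 'a + 'a set)"
  have chain: "causal_chain (past_points X l) (past_sep X l) ?t"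
    using s sS past_sep_Inl[OF sS sS] by (auto simp: causal_chain_def causal_def past_points_def)
  have lim: "limitin (past_space X l) ?t u sequentially"
    by (rule limitin_past_space[OF chain u]) (simp add: U, simp add: past_of_def)
  have "causal (past_sep X l) (?t k) u" for k
    using causal_past_sep[OF u, of "?t k"] U by (auto simp: past_of_def)
  then show "\<exists>s. range s \<subseteq> Inl ` topspace X \<and>
      (\<forall>k. causal (past_sep X l) (s k) (s (Suc k)) \<and> causal (past_sep X l) (s (Suc k)) u) \<and>
      limitin (past_space X l) s u sequentially"
    using lim chain sS by (intro exI[of _ ?t]) (auto simp: causal_chain_def)
qed

lemma forward_completion_past_space:
  "forward_completion X l (past_space X l) (past_sep X l) Inl"
  unfolding forward_completion_def
  using lorentzian_past_space forward_complete_past_space forward_dense_past_space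
    closedin_causal_topology[of _ "past_points X l" "past_sep X l"] past_sep_Inl
  by (auto simp: isometric_embedding_def past_points_def past_space_def)

end

section \<open>Comparing two completions\<close>

text \<open>
  This relation is symmetric in the two spaces, so each fact about the passage from \<open>Y\<close> to \<open>Z\<close>
  also yields the converse.
\<close>

definition common_limit ::
  "'a topology \<Rightarrow> ('a \<Rightarrow> 'a \<Rightarrow> ereal) \<Rightarrow> 'b topology \<Rightarrow> ('a \<Rightarrow> 'b) \<Rightarrow> 'c topology \<Rightarrow> ('a \<Rightarrow> 'c) \<Rightarrow>
    'b \<Rightarrow> 'c \<Rightarrow> bool" where
  "common_limit X l Y i Z j y z \<longleftrightarrow>
     (\<exists>s. causal_chain (topspace X) l s \<and>
        limitin Y (i \<circ> s) y sequentially \<and> limitin Z (j \<circ> s) z sequentially)"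

lemma common_limit_sym: "common_limit X l Y i Z j y z \<longleftrightarrow> common_limit X l Z j Y i z y"
  by (auto simp: common_limit_def)

lemma common_limit_topspace:
  assumes "common_limit X l Y i Z j y z"
  shows "y \<in> topspace Y" "z \<in> topspace Z"
  using assms by (auto simp: common_limit_def limitin_topspace)

lemma embedding_in_topspace:
  assumes "forward_completion X l Y m i" "x \<in> topspace X"
  shows "i x \<in> topspace Y"
  using assms by (auto simp: forward_completion_def isometric_embedding_def)

lemma embedding_isometric:
  assumes "forward_completion X l Y m i" "x \<in> topspace X" "y \<in> topspace X"
  shows "m (i x) (i y) = l x y"
  using assms by (auto simp: forward_completion_def isometric_embedding_def)

lemma embedding_causal:
  assumes "forward_completion X l Y m i" "x \<in> topspace X" "y \<in> topspace X"
  shows "causal m (i x) (i y) \<longleftrightarrow> causal l x y"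
  using embedding_isometric[OF assms] by (simp add: causal_def)

lemma forward_dense_chain:
  assumes fc: "forward_completion X l Y m i" and y: "y \<in> topspace Y"
  obtains s where "causal_chain (topspace X) l s" "limitin Y (i \<circ> s) y sequentially"
proof -
  obtain t where t: "range t \<subseteq> i ` topspace X" "\<And>k. causal m (t k) (t (Suc k))"
    "limitin Y t y sequentially"
    using fc y unfolding forward_completion_def forward_dense_def by blast
  have "\<exists>s. \<forall>k. s k \<in> topspace X \<and> t k = i (s k)"
    by (rule choice) (use t(1) in blast)
  then obtain s where s: "\<And>k. s k \<in> topspace X" "\<And>k. t k = i (s k)"
    by blast
  then have "t = i \<circ> s" by auto
  moreover have "causal_chain (topspace X) l s"
    using s t(2) embedding_causal[OF fc] by (auto simp: causal_chain_def)
  ultimately show ?thesis using that t(3) by blast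
qed

lemma limit_causal_le:
  assumes fc: "forward_completion X l Y m i" and lim: "limitin Y t y sequentially"
    and w: "w \<in> topspace Y" and t: "\<And>k. t k \<in> topspace Y" "\<And>k. causal m (t k) w"
  shows "causal m y w"
proof -
  have "closedin Y (Jpast (topspace Y) m w)"
    using fc w by (auto simp: forward_completion_def)
  then have "y \<in> Jpast (topspace Y) m w"
    by (rule limitin_closedin[OF lim]) (use t in \<open>auto simp: Jpast_def\<close>)
  then show ?thesis by (simp add: Jpast_def)
qed

lemma causal_le_limit:
  assumes fc: "forward_completion X l Y m i" and lim: "limitin Y t y sequentially"
    and w: "w \<in> topspace Y" and t: "\<And>k. t k \<in> topspace Y" "\<forall>\<^sub>F k in sequentially. causal m w (t k)"
  shows "causal m w y"
proof -
  have "closedin Y (Jfut (topspace Y) m w)"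
    using fc w by (auto simp: forward_completion_def)
  then have "y \<in> Jfut (topspace Y) m w"
    by (rule limitin_closedin[OF lim]) (use t in \<open>auto simp: Jfut_def\<close>)
  then show ?thesis by (simp add: Jfut_def)
qed

lemma chain_causal_le_limit:
  assumes X: "lorentzian_pre_length_space X l" and fc: "forward_completion X l Y m i"
    and s: "causal_chain (topspace X) l s" and lim: "limitin Y (i \<circ> s) y sequentially"
  shows "causal m (i (s k)) y"
proof -
  have sX: "s n \<in> topspace X" for n using s by (auto simp: causal_chain_def)
  have "\<forall>\<^sub>F n in sequentially. causal m (i (s k)) ((i \<circ> s) n)"
    using causal_chain_mono[OF X s] embedding_causal[OF fc sX sX]
    by (auto simp: eventually_sequentially)
  then show ?thesis
    by (rule causal_le_limit[OF fc lim, rotated -1])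
      (use sX embedding_in_topspace[OF fc] in auto)
qed

text \<open>
  Both sides are the limit of the same sequence \<open>tau l (s k) (s' k)\<close>.
\<close>

lemma tau_common_limit:
  assumes Y: "forward_completion X l Y m i" "continuous_time_separation Y m"
    and Z: "forward_completion X l Z n j" "continuous_time_separation Z n"
    and c: "common_limit X l Y i Z j y z" "common_limit X l Y i Z j y' z'"
  shows "tau m y y' = tau n z z'"
proof -
  obtain s where s: "causal_chain (topspace X) l s"
    "limitin Y (i \<circ> s) y sequentially" "limitin Z (j \<circ> s) z sequentially"
    using c(1) by (auto simp: common_limit_def)
  obtain s' where s': "causal_chain (topspace X) l s'"
    "limitin Y (i \<circ> s') y' sequentially" "limitin Z (j \<circ> s') z' sequentially"
    using c(2) by (auto simp: common_limit_def)
  have sX: "s k \<in> topspace X" "s' k \<in> topspace X" for k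
    using s s' by (auto simp: causal_chain_def)
  have "limitin (prod_topology Y Y) (\<lambda>k. (i (s k), i (s' k))) (y, y') sequentially"
    using s s' by (simp add: limitin_pairwise o_def)
  then have "limitin euclidean ((\<lambda>(x, y). tau m x y) \<circ> (\<lambda>k. (i (s k), i (s' k)))) (tau m y y') sequentially"
    using continuous_map_limit[OF Y(2)[unfolded continuous_time_separation_def]] by fastforce
  then have "(\<lambda>k. tau m (i (s k)) (i (s' k))) \<longlonglongrightarrow> tau m y y'"
    by (simp add: o_def limitin_canonical_iff)
  then have 1: "(\<lambda>k. tau l (s k) (s' k)) \<longlonglongrightarrow> tau m y y'"
    using embedding_isometric[OF Y(1) sX] by (simp add: tau_def)
  have "limitin (prod_topology Z Z) (\<lambda>k. (j (s k), j (s' k))) (z, z') sequentially"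
    using s s' by (simp add: limitin_pairwise o_def)
  then have "limitin euclidean ((\<lambda>(x, y). tau n x y) \<circ> (\<lambda>k. (j (s k), j (s' k)))) (tau n z z') sequentially"
    using continuous_map_limit[OF Z(2)[unfolded continuous_time_separation_def]] by fastforce
  then have "(\<lambda>k. tau n (j (s k)) (j (s' k))) \<longlonglongrightarrow> tau n z z'"
    by (simp add: o_def limitin_canonical_iff)
  then have 2: "(\<lambda>k. tau l (s k) (s' k)) \<longlonglongrightarrow> tau n z z'"
    using embedding_isometric[OF Z(1) sX] by (simp add: tau_def)
  show ?thesis using 1 2 by (rule LIMSEQ_unique)
qed

lemma common_limit_embedding:
  assumes "lorentzian_pre_length_space X l" "forward_completion X l Y m i" "forward_completion X l Z n j"
    and "x \<in> topspace X"
  shows "common_limit X l Y i Z j (i x) (j x)"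
  unfolding common_limit_def
  using assms(4) embedding_in_topspace[OF assms(2,4)] embedding_in_topspace[OF assms(3,4)]
    causal_refl[OF assms(1,4)]
  by (intro exI[of _ "\<lambda>_. x"]) (auto simp: causal_chain_def o_def)

text \<open>
  Causality without chronology is invisible to \<open>tau\<close>, so it is recovered from nearby points
  in the chronological future of \<open>z\<close>, if \<open>z\<close> is new, and from \<open>z\<close> as an upper bound in \<open>X\<close> otherwise.
\<close>

lemma causal_point_transfer:
  assumes X: "lorentzian_pre_length_space X l"
    and Y: "forward_completion X l Y m i" "continuous_time_separation Y m"
    and Z: "forward_completion X l Z n j" "continuous_time_separation Z n"
      "new_points_approximable (topspace X) Z n j"
    and c: "common_limit X l Y i Z j y z"
    and p: "p \<in> topspace X" "causal m (i p) y"
  shows "causal n (j p) z"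
proof -
  have Yl: "lorentzian_pre_length_space Y m" and Zl: "lorentzian_pre_length_space Z n"
    using Y Z by (auto simp: forward_completion_def)
  note inY = embedding_in_topspace[OF Y(1)] and inZ = embedding_in_topspace[OF Z(1)]
  obtain s where s: "causal_chain (topspace X) l s"
    "limitin Y (i \<circ> s) y sequentially" "limitin Z (j \<circ> s) z sequentially"
    using c by (auto simp: common_limit_def)
  have sX: "s k \<in> topspace X" for k using s by (auto simp: causal_chain_def)
  have y: "y \<in> topspace Y" and z: "z \<in> topspace Z" using common_limit_topspace[OF c] by auto
  show ?thesis
  proof (cases "z \<in> j ` topspace X")
    case True
    then obtain q where q: "q \<in> topspace X" "z = j q" by blast
    have "causal l (s k) q" for k
      using chain_causal_le_limit[OF X Z(1) s(1,3)] embedding_causal[OF Z(1) sX q(1)] q(2) by auto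
    then have "causal m ((i \<circ> s) k) (i q)" for k
      using embedding_causal[OF Y(1) sX q(1)] by simp
    then have "causal m y (i q)"
      using limit_causal_le[OF Y(1) s(2) inY[OF q(1)]] sX inY by simp
    then have "causal m (i p) (i q)"
      using causal_trans[OF Yl inY[OF p(1)] y inY[OF q(1)] p(2)] by blast
    then show ?thesis
      using embedding_causal[OF Y(1) p(1) q(1)] embedding_causal[OF Z(1) p(1) q(1)] q(2) by simp
  next
    case False
    \<comment> \<open>\<open>I\<^sup>+(z)\<close> is open, so \<open>w\<close> is a limit of points of \<open>X\<close> inside it; each of them lies above \<open>p\<close>.\<close>
    have fut: "causal n (j p) w" if w: "w \<in> Ifut (topspace Z) n z" for w
    proof -
      have wZ: "w \<in> topspace Z" using w by (simp add: Ifut_def)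
      obtain t where t: "causal_chain (topspace X) l t" "limitin Z (j \<circ> t) w sequentially"
        using forward_dense_chain[OF Z(1) wZ] by blast
      have tX: "t k \<in> topspace X" for k using t by (auto simp: causal_chain_def)
      have "\<forall>\<^sub>F k in sequentially. (j \<circ> t) k \<in> Ifut (topspace Z) n z"
        using t(2) w openin_Ifut[OF Zl z] by (auto simp: limitin_def)
      moreover have "causal n (j p) (j q)" if q: "q \<in> topspace X" "j q \<in> Ifut (topspace Z) n z" for q
      proof -
        have "tau m y (i q) = tau n z (j q)"
          by (rule tau_common_limit[OF Y Z(1,2) c common_limit_embedding[OF X Y(1) Z(1) q(1)]])
        then have "causal m y (i q)"
          using q(2) by (auto simp: Ifut_def chron_def causal_def tau_def max_def split: if_splits)
        then have "causal m (i p) (i q)"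
          using causal_trans[OF Yl inY[OF p(1)] y inY[OF q(1)] p(2)] by blast
        then show ?thesis
          using embedding_causal[OF Y(1) p(1) q(1)] embedding_causal[OF Z(1) p(1) q(1)] by simp
      qed
      ultimately have "\<forall>\<^sub>F k in sequentially. causal n (j p) ((j \<circ> t) k)"
        using tX by (auto elim!: eventually_mono)
      then show ?thesis
        using causal_le_limit[OF Z(1) t(2) inZ[OF p(1)]] tX inZ by simp
    qed
    have "z \<in> Z closure_of (Ifut (topspace Z) n z)"
      using Z(3) False z by (auto simp: new_points_approximable_def)
    moreover have "Z closure_of (Ifut (topspace Z) n z) \<subseteq> Jfut (topspace Z) n (j p)"
    proof (rule closure_of_minimal)
      show "Ifut (topspace Z) n z \<subseteq> Jfut (topspace Z) n (j p)"
        using fut by (auto simp: Jfut_def Ifut_def)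
      show "closedin Z (Jfut (topspace Z) n (j p))"
        using Z(1) inZ[OF p(1)] by (auto simp: forward_completion_def)
    qed
    ultimately show ?thesis by (auto simp: Jfut_def)
  qed
qed

lemma causal_transfer:
  assumes X: "lorentzian_pre_length_space X l"
    and Y: "forward_completion X l Y m i" "continuous_time_separation Y m"
    and Z: "forward_completion X l Z n j" "continuous_time_separation Z n"
      "new_points_approximable (topspace X) Z n j"
    and c: "common_limit X l Y i Z j y z" "common_limit X l Y i Z j y' z'"
    and le: "causal m y y'"
  shows "causal n z z'"
proof -
  have Yl: "lorentzian_pre_length_space Y m"
    using Y by (auto simp: forward_completion_def)
  obtain s where s: "causal_chain (topspace X) l s"
    "limitin Y (i \<circ> s) y sequentially" "limitin Z (j \<circ> s) z sequentially"
    using c(1) by (auto simp: common_limit_def)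
  have sX: "s k \<in> topspace X" for k using s by (auto simp: causal_chain_def)
  have "causal n (j (s k)) z'" for k
  proof (rule causal_point_transfer[OF X Y Z c(2) sX])
    show "causal m (i (s k)) y'"
      by (rule causal_trans[OF Yl embedding_in_topspace[OF Y(1) sX] _ _
            chain_causal_le_limit[OF X Y(1) s(1,2)] le])
        (use common_limit_topspace[OF c(1)] common_limit_topspace[OF c(2)] in auto)
  qed
  then show ?thesis
    using limit_causal_le[OF Z(1) s(3) common_limit_topspace(2)[OF c(2)]]
      embedding_in_topspace[OF Z(1) sX] by simp
qed

text \<open>
  Since \<open>-\<infinity>\<close> is the only value below zero, the time separation and the causal relation together determine \<open>l\<close>.
\<close>

lemma common_limit_isometric:
  assumes X: "lorentzian_pre_length_space X l"
    and Y: "forward_completion X l Y m i" "continuous_time_separation Y m"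
      "new_points_approximable (topspace X) Y m i"
    and Z: "forward_completion X l Z n j" "continuous_time_separation Z n"
      "new_points_approximable (topspace X) Z n j"
    and c: "common_limit X l Y i Z j y z" "common_limit X l Y i Z j y' z'"
  shows "m y y' = n z z'"
proof -
  have "causal m y y' \<longleftrightarrow> causal n z z'"
    using causal_transfer[OF X Y(1,2) Z c] causal_transfer[OF X Z(1,2) Y, of z y z' y'] c
    by (auto simp: common_limit_sym[of X l Y])
  moreover have "tau m y y' = tau n z z'"
    by (rule tau_common_limit[OF Y(1,2) Z(1,2) c])
  moreover have "m y y' = -\<infinity> \<or> 0 \<le> m y y'" "n z z' = -\<infinity> \<or> 0 \<le> n z z'"
    using Y(1) Z(1) common_limit_topspace[OF c(1)] common_limit_topspace[OF c(2)]
    by (auto simp: forward_completion_def lorentzian_pre_length_space_def)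
  ultimately show ?thesis
    by (auto simp: tau_def causal_def max_def split: if_splits)
qed

text \<open>
  Forward completeness needs an upper bound inside \<open>Z\<close>, whereas \<open>y\<close> bounds the sequence only in \<open>Y\<close>. A new point
  \<open>y\<close> has a nonempty open chronological future, which contains a point \<open>q\<close> of \<open>X\<close>, and \<open>q\<close> is a bound in
  both spaces.
\<close>

lemma common_limit_exists:
  assumes X: "lorentzian_pre_length_space X l"
    and Y: "forward_completion X l Y m i" "new_points_approximable (topspace X) Y m i"
    and Z: "forward_completion X l Z n j" and y: "y \<in> topspace Y"
  shows "\<exists>z. common_limit X l Y i Z j y z"
proof (cases "y \<in> i ` topspace X")
  case True
  then show ?thesis using common_limit_embedding[OF X Y(1) Z] by blast
next
  case False
  have Yl: "lorentzian_pre_length_space Y m" using Y by (auto simp: forward_completion_def)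
  note inY = embedding_in_topspace[OF Y(1)] and inZ = embedding_in_topspace[OF Z(1)]
  have "y \<in> Y closure_of (Ifut (topspace Y) m y)"
    using Y(2) False y by (auto simp: new_points_approximable_def)
  then have "Ifut (topspace Y) m y \<noteq> {}" by auto
  then obtain w where w: "w \<in> Ifut (topspace Y) m y" by blast
  then obtain t where t: "causal_chain (topspace X) l t" "limitin Y (i \<circ> t) w sequentially"
    using forward_dense_chain[OF Y(1), of w] by (auto simp: Ifut_def)
  have "\<forall>\<^sub>F k in sequentially. (i \<circ> t) k \<in> Ifut (topspace Y) m y"
    using t(2) w openin_Ifut[OF Yl y] by (auto simp: limitin_def)
  then obtain k where "(i \<circ> t) k \<in> Ifut (topspace Y) m y"
    by (metis eventually_sequentially order_refl)
  then obtain q where q: "q \<in> topspace X" "causal m y (i q)"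
    using t(1) chron_imp_causal by (fastforce simp: Ifut_def causal_chain_def)
  obtain s where s: "causal_chain (topspace X) l s" "limitin Y (i \<circ> s) y sequentially"
    using forward_dense_chain[OF Y(1) y] by blast
  have sX: "s k \<in> topspace X" for k using s by (auto simp: causal_chain_def)
  have "causal m (i (s k)) (i q)" for k
    by (rule causal_trans[OF Yl inY[OF sX] y inY[OF q(1)] chain_causal_le_limit[OF X Y(1) s] q(2)])
  then have sq: "causal l (s k) q" for k
    using embedding_causal[OF Y(1) sX q(1)] by simp
  have "range (j \<circ> s) \<subseteq> topspace Z" using inZ sX by auto
  moreover have "causal n ((j \<circ> s) k) ((j \<circ> s) (Suc k)) \<and> causal n ((j \<circ> s) (Suc k)) (j q)" for k
    using sq s(1) embedding_causal[OF Z] sX q(1) by (simp add: causal_chain_def)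
  moreover have "forward_complete Z n" using Z by (simp add: forward_completion_def)
  ultimately obtain z where "limitin Z (j \<circ> s) z sequentially"
    unfolding forward_complete_def using inZ[OF q(1)] by blast
  then show ?thesis using s by (auto simp: common_limit_def)
qed

lemma causal_antisym:
  assumes "closed_causal_order Y m" "x \<in> topspace Y" "y \<in> topspace Y" "causal m x y" "causal m y x"
  shows "x = y"
  using assms by (auto simp: closed_causal_order_def partial_order_on_def antisym_def causal_rel_def)

text \<open>
  Apply preservation of the causal relation to \<open>y \<le> y\<close>: it gives \<open>z \<le> z'\<close> and \<open>z' \<le> z\<close>.
\<close>

lemma common_limit_unique:
  assumes X: "lorentzian_pre_length_space X l"
    and Y: "forward_completion X l Y m i" "continuous_time_separation Y m"
      "new_points_approximable (topspace X) Y m i"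
    and Z: "forward_completion X l Z n j" "continuous_time_separation Z n"
      "new_points_approximable (topspace X) Z n j" "closed_causal_order Z n"
    and c: "common_limit X l Y i Z j y z" "common_limit X l Y i Z j y z'"
  shows "z = z'"
proof -
  have "lorentzian_pre_length_space Y m" using Y by (simp add: forward_completion_def)
  then have "causal m y y" by (rule causal_refl[OF _ common_limit_topspace(1)[OF c(1)]])
  then have "causal n z z'" "causal n z' z"
    using causal_transfer[OF X Y(1,2) Z(1-3)] c by blast+
  then show ?thesis
    using causal_antisym[OF Z(4)] common_limit_topspace[OF c(1)] common_limit_topspace[OF c(2)] by blast
qed

lemma forward_completion_unique:
  assumes X: "lorentzian_pre_length_space X l"
    and Y: "forward_completion X l Y m i" "continuous_time_separation Y m"
      "new_points_approximable (topspace X) Y m i" "closed_causal_order Y m"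
    and Z: "forward_completion X l Z n j" "continuous_time_separation Z n"
      "new_points_approximable (topspace X) Z n j" "closed_causal_order Z n"
  shows "\<exists>f. isometry Y m Z n f"
proof -
  let ?R = "common_limit X l Y i Z j"
  have "\<exists>f. \<forall>y\<in>topspace Y. ?R y (f y)"
    by (rule bchoice) (use common_limit_exists[OF X Y(1,3) Z(1)] in blast)
  then obtain f where f: "\<And>y. y \<in> topspace Y \<Longrightarrow> ?R y (f y)" by blast
  have "bij_betw f (topspace Y) (topspace Z)"
    unfolding bij_betw_def
  proof
    show "inj_on f (topspace Y)"
    proof (rule inj_onI)
      fix y y' assume "y \<in> topspace Y" "y' \<in> topspace Y" "f y = f y'"
      then have "common_limit X l Z j Y i (f y) y" "common_limit X l Z j Y i (f y) y'"
        using f[of y] f[of y'] by (auto simp: common_limit_sym[of X l Y])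
      then show "y = y'" by (rule common_limit_unique[OF X Z(1-3) Y])
    qed
    show "f ` topspace Y = topspace Z"
    proof
      show "f ` topspace Y \<subseteq> topspace Z" using common_limit_topspace(2)[OF f] by auto
      show "topspace Z \<subseteq> f ` topspace Y"
      proof
        fix z assume "z \<in> topspace Z"
        then obtain y where y: "?R y z"
          using common_limit_exists[OF X Z(1,3) Y(1)] by (auto simp: common_limit_sym[of X l Y])
        then have "y \<in> topspace Y" by (rule common_limit_topspace(1))
        moreover from this have "z = f y"
          by (intro common_limit_unique[OF X Y(1-3) Z y] f)
        ultimately show "z \<in> f ` topspace Y" by blast
      qed
    qed
  qed
  moreover have "n (f y) (f y') = m y y'" if "y \<in> topspace Y" "y' \<in> topspace Y" for y y'
    using common_limit_isometric[OF X Y(1-3) Z(1-3)] f that by metis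
  ultimately show ?thesis unfolding isometry_def by blast
qed

theorem theorem7p2:
  fixes X :: "'a topology" and l :: "'a \<Rightarrow> 'a \<Rightarrow> ereal"
  assumes "lorentzian_pre_length_space X l"
  shows "(\<exists>(Y :: ('a + 'a set) topology) m i. forward_completion X l Y m i) \<and>
    (\<forall>(Y :: 'b topology) m i (Z :: 'c topology) n j.
       forward_completion X l Y m i \<and> continuous_time_separation Y m \<and>
       closed_causal_order Y m \<and> new_points_approximable (topspace X) Y m i \<and>
       forward_completion X l Z n j \<and> continuous_time_separation Z n \<and>
       closed_causal_order Z n \<and> new_points_approximable (topspace X) Z n j
       \<longrightarrow> (\<exists>f. isometry Y m Z n f))"
  using forward_completion_past_space[OF assms] forward_completion_unique[OF assms] by blast

end
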